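(* Let $Q$ be the quiver on vertices $\{1,2,3,4,5\}$ with arrows $1\to2$, $1\to5$, $3\to1$, $4\to1$, $4\to5$, $5\to2$, $5\to3$, two arrows $2\to3$ and two arrows $3\to4$, with initial seed $(Q,(x_1,\dots,x_5))$, $x_1,\dots,x_5$ indeterminates. Define $x_n$ for all $n\in\mathbb{Z}$ by $x_n=(x_{n-1}x_{n-4}+x_{n-2}x_{n-3})/x_{n-5}$ for $n\ge6$ and $x_n=(x_{n+1}x_{n+4}+x_{n+2}x_{n+3})/x_{n+5}$ for $n\le0$; let $A=\frac{x_1x_5+x_3^2}{x_2x_4}$, $B=\frac{x_2x_6+x_4^2}{x_3x_5}$. Define $g(s,k)=\lfloor s/2\rfloor\lfloor (s+1)/2\rfloor$ if $k$ is even and $g(s,k)=\lfloor (s-1)/2\rfloor\lfloor s/2\rfloor$ if $k$ is odd, and set $\rho_1^{k}:=\rho_2^{-k}$ for $k<0$. Then for all $k\in\mathbb{Z}$ and $s\in\mathbb{Z}_{\ge0}$, the ordered cluster obtained by applying $\rho_1^{k}(\rho_3\rho_1)^s$ to the initial seed is $$\big(A^{g(s+1,k)}B^{g(s+1,k+1)}x_{k+s+1},\ A^{g(s,k)}B^{g(s,k+1)}x_{k+s+2},\ A^{g(s+1,k)}B^{g(s+1,k+1)}x_{k+s+3},$$ $$A^{g(s,k)}B^{g(s,k+1)}x_{k+s+4},\ A^{g(s+1,k)}B^{g(s+1,k+1)}x_{k+s+5}\big).$$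
   Context: A seed is a pair (quiver on $\{1,\dots,5\}$ without loops or 2-cycles, ordered cluster $(y_1,\dots,y_5)$). Mutation $\mu_i$: for each 2-path $j\to i\to k$ add an arrow $j\to k$; reverse arrows at $i$; delete 2-cycles; replace $y_i$ by $\big(\prod_{i\to j}y_j^{a_{i\to j}}+\prod_{j\to i}y_j^{a_{j\to i}}\big)/y_i$ ($a_{i\to j}$ = number of arrows $i\to j$ before mutation). For a permutation $\sigma$ in cycle notation, applying $\sigma$ relabels vertex $i$ as $\sigma(i)$ (variable at $i$ moves to $\sigma(i)$); e.g. $(54321)$ sends $1\mapsto5$ and $i\mapsto i-1$ for $i\ge2$. Operations compose left to right (leftmost first): $\rho_1=\mu_1\circ(54321)$, $\rho_2=\mu_5\circ(12345)$, $\rho_3=\mu_2\circ\mu_4\circ(24)$. In a product $\rho_a\rho_b$, $\rho_a$ is applied first; powers are repeated products and $\rho^0$ is the identity. *)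

theory Defs
  imports
    "HOL-Computational_Algebra.Fraction_Field"
    "HOL-Computational_Algebra.Polynomial"
    "HOL-Combinatorics.Cycles"
begin

text \<open>A quiver is given by its arrow multiplicities: \<open>a i j\<close> is the number of arrows
  from \<open>i\<close> to \<open>j\<close>.\<close>

type_synonym quiver = "nat \<Rightarrow> nat \<Rightarrow> nat"
type_synonym 'a seed = "quiver \<times> (nat \<Rightarrow> 'a)"

definition vertices :: "nat set" where
  "vertices = {1..5}"

definition is_quiver :: "quiver \<Rightarrow> bool" where
  "is_quiver a \<longleftrightarrow>
     (\<forall>i j. a i j > 0 \<longrightarrow> i \<in> vertices \<and> j \<in> vertices) \<and>
     (\<forall>i. a i i = 0) \<and>
     (\<forall>i j. a i j = 0 \<or> a j i = 0)"

definition add_paths :: "nat \<Rightarrow> quiver \<Rightarrow> quiver" where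
  "add_paths i a = (\<lambda>j k. a j k + a j i * a i k)"

definition reverse_at :: "nat \<Rightarrow> quiver \<Rightarrow> quiver" where
  "reverse_at i a = (\<lambda>j k. if j = i \<or> k = i then a k j else a j k)"

text \<open>Truncated subtraction: opposite arrows between \<open>j\<close> and \<open>k\<close> cancel in pairs.\<close>

definition delete_2cycles :: "quiver \<Rightarrow> quiver" where
  "delete_2cycles a = (\<lambda>j k. a j k - a k j)"

definition mutate_quiver :: "nat \<Rightarrow> quiver \<Rightarrow> quiver" where
  "mutate_quiver i a = delete_2cycles (reverse_at i (add_paths i a))"

definition mutate :: "nat \<Rightarrow> 'a::field seed \<Rightarrow> 'a seed" where
  "mutate i S = (case S of (a, y) \<Rightarrow>
     (mutate_quiver i a,
      y(i := ((\<Prod>j\<in>vertices. y j ^ a i j) + (\<Prod>j\<in>vertices. y j ^ a j i)) / y i)))"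

text \<open>The data at vertex \<open>i\<close> moves to vertex \<open>\<sigma> i\<close>.\<close>

definition relabel :: "(nat \<Rightarrow> nat) \<Rightarrow> 'a seed \<Rightarrow> 'a seed" where
  "relabel \<sigma> S = (case S of (a, y) \<Rightarrow>
     (\<lambda>i j. a (inv \<sigma> i) (inv \<sigma> j), \<lambda>i. y (inv \<sigma> i)))"

text \<open>Products of operations are read left to right, i.e. opposite to \<open>\<circ>\<close>.\<close>

definition rho1 :: "'a::field seed \<Rightarrow> 'a seed" where
  "rho1 = relabel (cycle_of_list [5, 4, 3, 2, 1]) \<circ> mutate 1"

definition rho2 :: "'a::field seed \<Rightarrow> 'a seed" where
  "rho2 = relabel (cycle_of_list [1, 2, 3, 4, 5]) \<circ> mutate 5"

definition rho3 :: "'a::field seed \<Rightarrow> 'a seed" where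
  "rho3 = relabel (cycle_of_list [2, 4]) \<circ> mutate 4 \<circ> mutate 2"

definition rho1_pow :: "int \<Rightarrow> 'a::field seed \<Rightarrow> 'a seed" where
  "rho1_pow k = (if k \<ge> 0 then rho1 ^^ nat k else rho2 ^^ nat (- k))"

definition ordered_cluster :: "'a seed \<Rightarrow> 'a list" where
  "ordered_cluster S = map (snd S) [1, 2, 3, 4, 5]"

definition Q :: quiver where
  "Q i j = count_list
     [(1, 2), (1, 5), (3, 1), (4, 1), (4, 5), (5, 2), (5, 3),
      (2, 3), (2, 3), (3, 4), (3, 4)] (i, j)"

text \<open>The field of rational functions over the rationals in five indeterminates, as the fraction
  field of the iterated polynomial ring; the innermost variable is the first one.\<close>

type_synonym ratfun = "rat poly poly poly poly poly fract"

definition indet :: "int \<Rightarrow> ratfun" where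
  "indet n =
     (if n = 1 then Fraction_Field.Fract [:[:[:[:[:0, 1:]:]:]:]:] 1
      else if n = 2 then Fraction_Field.Fract [:[:[:[:0, 1:]:]:]:] 1
      else if n = 3 then Fraction_Field.Fract [:[:[:0, 1:]:]:] 1
      else if n = 4 then Fraction_Field.Fract [:[:0, 1:]:] 1
      else if n = 5 then Fraction_Field.Fract [:0, 1:] 1
      else 0)"

function x :: "int \<Rightarrow> ratfun" where
  "x n =
     (if n \<ge> 6 then (x (n - 1) * x (n - 4) + x (n - 2) * x (n - 3)) / x (n - 5)
      else if n \<le> 0 then (x (n + 1) * x (n + 4) + x (n + 2) * x (n + 3)) / x (n + 5)
      else indet n)"
  by pat_completeness auto
termination
  by (relation "measure (\<lambda>n. nat \<bar>n - 3\<bar>)") auto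

declare x.simps [simp del]

definition initial_seed :: "ratfun seed" where
  "initial_seed = (Q, \<lambda>i. indet (int i))"

definition A :: ratfun where
  "A = (x 1 * x 5 + (x 3)\<^sup>2) / (x 2 * x 4)"

definition B :: ratfun where
  "B = (x 2 * x 6 + (x 4)\<^sup>2) / (x 3 * x 5)"

text \<open>Division on \<open>int\<close> rounds down, so it is the floor of the quotient.\<close>

definition g :: "int \<Rightarrow> int \<Rightarrow> int" where
  "g s k = (if even k then (s div 2) * ((s + 1) div 2) else ((s - 1) div 2) * (s div 2))"

lemma is_quiver_Q: "is_quiver Q"
  by (auto simp: is_quiver_def Q_def vertices_def split: if_splits)

lemma is_quiver_mutate:
  assumes "is_quiver a" "i \<in> vertices"
  shows "is_quiver (mutate_quiver i a)"
proof -
  have supp: "a j k = 0" if "j \<notin> vertices \<or> k \<notin> vertices" for j k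
    using assms(1) that by (auto simp: is_quiver_def)
  show ?thesis
    unfolding is_quiver_def
  proof (intro conjI allI impI)
    fix j k
    assume *: "mutate_quiver i a j k > 0"
    show "j \<in> vertices"
      by (rule ccontr) (use * in \<open>simp add: mutate_quiver_def delete_2cycles_def
            reverse_at_def add_paths_def supp split: if_splits\<close>)
    show "k \<in> vertices"
      by (rule ccontr) (use * in \<open>simp add: mutate_quiver_def delete_2cycles_def
            reverse_at_def add_paths_def supp split: if_splits\<close>)
  qed (auto simp: mutate_quiver_def delete_2cycles_def)
qed

end

theory Submission
  imports Defs "HOL-Library.Periodic_Fun"
begin

text \<open>All three operations fix the quiver, so only the cluster moves. On clusters \<open>\<rho>\<^sub>1\<close> and
  \<open>\<rho>\<^sub>2\<close> are the two directions of the Somos-5 recurrence. The quantity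
  \<open>C\<^sub>n = (x\<^sub>n x\<^sub>n\<^sub>+\<^sub>4 + x\<^sub>n\<^sub>+\<^sub>2\<^sup>2) / (x\<^sub>n\<^sub>+\<^sub>1 x\<^sub>n\<^sub>+\<^sub>3)\<close> has period 2 in \<open>n\<close>, so it equals \<open>A\<close> or \<open>B\<close>
  according to the parity of \<open>n\<close>. A cluster of the form
  \<open>(p x\<^sub>n, r x\<^sub>n\<^sub>+\<^sub>1, p x\<^sub>n\<^sub>+\<^sub>2, r x\<^sub>n\<^sub>+\<^sub>3, p x\<^sub>n\<^sub>+\<^sub>4)\<close> is sent by \<open>\<rho>\<^sub>3\<rho>\<^sub>1\<close> to one of the same form
  with \<open>(n, p, r)\<close> replaced by \<open>(n + 1, C\<^sub>n p\<^sup>2 / r, p)\<close>, and the exponents given by \<open>g\<close> solve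
  this second-order recurrence. Every division is legitimate because all the rational functions
  involved are positive for the order on the fraction field induced by leading coefficients.\<close>

section \<open>Quivers up to relabelling\<close>

lemma cycle_of_list_snoc:
  "cycle_of_list (cs @ [i, j]) = cycle_of_list (cs @ [i]) \<circ> Transposition.transpose i j"
  by (induction cs rule: cycle_of_list.induct) (simp_all add: comp_assoc)

lemma inv_cycle_of_list: "inv (cycle_of_list cs) = cycle_of_list (rev cs)"
proof (induction cs rule: cycle_of_list.induct)
  case (1 i j cs)
  have "inv (cycle_of_list (i # j # cs)) =
      inv (cycle_of_list (j # cs)) \<circ> Transposition.transpose i j"
    using o_inv_distrib[OF permutation_bijective[OF permutation_swap_id]
        permutation_bijective[OF permutation_of_cycle]] by simp
  also have "\<dots> = cycle_of_list (rev (i # j # cs))"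
    using 1 by (simp add: cycle_of_list_snoc transpose_commute)
  finally show ?case .
qed (simp_all add: inv_id)

definition relabel_quiver :: "(nat \<Rightarrow> nat) \<Rightarrow> quiver \<Rightarrow> quiver" where
  "relabel_quiver \<sigma> a = (\<lambda>i j. a (inv \<sigma> i) (inv \<sigma> j))"

lemma is_quiver_relabel:
  assumes "is_quiver a" "\<sigma> permutes vertices"
  shows "is_quiver (relabel_quiver \<sigma> a)"
  using assms(1) unfolding is_quiver_def relabel_quiver_def
  by (metis permutes_in_image[OF permutes_inv[OF assms(2)]])

lemma quiver_eqI:
  assumes "is_quiver a" "is_quiver b"
    and eq: "\<And>i j. i \<in> vertices \<Longrightarrow> j \<in> vertices \<Longrightarrow> a i j = b i j"
  shows "a = b"
proof (intro ext)
  fix i j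
  have "a i j = 0" "b i j = 0" if "\<not> (i \<in> vertices \<and> j \<in> vertices)"
    using that assms(1,2) unfolding is_quiver_def by (metis gr0I)+
  then show "a i j = b i j"
    using eq by metis
qed

lemma relabel_cycle_eqI:
  assumes "is_quiver a" "is_quiver b" "set cs \<subseteq> vertices"
    and "\<forall>i\<in>vertices. \<forall>j\<in>vertices.
      a (cycle_of_list (rev cs) i) (cycle_of_list (rev cs) j) = b i j"
  shows "relabel_quiver (cycle_of_list cs) a = b"
proof (rule quiver_eqI)
  show "is_quiver (relabel_quiver (cycle_of_list cs) a)"
    using assms(1) permutes_subset[OF cycle_permutes assms(3)] by (rule is_quiver_relabel)
qed (use assms in \<open>simp_all add: relabel_quiver_def inv_cycle_of_list\<close>)

section \<open>The operations on seeds with quiver \<open>Q\<close>\<close>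

lemma vertices_eq: "vertices = {1, 2, 3, 4, 5}"
  by (auto simp: vertices_def)

lemma Q_table:
  "Q 1 1 = 0" "Q 1 2 = 1" "Q 1 3 = 0" "Q 1 4 = 0" "Q 1 5 = 1"
  "Q 2 1 = 0" "Q 2 2 = 0" "Q 2 3 = 2" "Q 2 4 = 0" "Q 2 5 = 0"
  "Q 3 1 = 1" "Q 3 2 = 0" "Q 3 3 = 0" "Q 3 4 = 2" "Q 3 5 = 0"
  "Q 4 1 = 1" "Q 4 2 = 0" "Q 4 3 = 0" "Q 4 4 = 0" "Q 4 5 = 1"
  "Q 5 1 = 0" "Q 5 2 = 1" "Q 5 3 = 1" "Q 5 4 = 0" "Q 5 5 = 0"
  by (simp_all add: Q_def)

lemma mutate_quiver_apply:
  "mutate_quiver i a j k =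
    (if j = i \<or> k = i then (a k j + a k i * a i j) - (a j k + a j i * a i k)
     else (a j k + a j i * a i k) - (a k j + a k i * a i j))"
  by (auto simp: mutate_quiver_def delete_2cycles_def reverse_at_def add_paths_def)

lemma relabel_mutate_Q:
  "relabel_quiver (cycle_of_list [5, 4, 3, 2, 1]) (mutate_quiver 1 Q) = Q"
  "relabel_quiver (cycle_of_list [1, 2, 3, 4, 5]) (mutate_quiver 5 Q) = Q"
  "relabel_quiver (cycle_of_list [2, 4]) (mutate_quiver 4 (mutate_quiver 2 Q)) = Q"
  \<comment> \<open>Enumerating the vertices first keeps the simplifier from splitting on symbolic ones.\<close>
  by (rule relabel_cycle_eqI; (unfold vertices_eq ball_simps)?;
      simp add: is_quiver_mutate is_quiver_Q vertices_eq transpose_def mutate_quiver_apply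
        Q_table del: One_nat_def)+

lemma mutate_eq:
  "mutate i S = (mutate_quiver i (fst S), (snd S)
    (i := ((\<Prod>j\<in>vertices. snd S j ^ fst S i j) + (\<Prod>j\<in>vertices. snd S j ^ fst S j i)) / snd S i))"
  by (simp add: mutate_def split_beta)

lemma relabel_cycle_eq:
  "relabel (cycle_of_list cs) S =
    (relabel_quiver (cycle_of_list cs) (fst S), snd S \<circ> cycle_of_list (rev cs))"
  by (simp add: relabel_def relabel_quiver_def inv_cycle_of_list split_beta comp_def)

lemma rho_eq_if_quiver_Q:
  assumes "fst S = Q"
  shows "rho1 S = (Q, snd (mutate 1 S) \<circ> cycle_of_list [1, 2, 3, 4, 5])"
    and "rho2 S = (Q, snd (mutate 5 S) \<circ> cycle_of_list [5, 4, 3, 2, 1])"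
    and "rho3 S = (Q, snd (mutate 4 (mutate 2 S)) \<circ> cycle_of_list [4, 2])"
  by (simp_all add: rho1_def rho2_def rho3_def relabel_cycle_eq mutate_eq relabel_mutate_Q assms
      del: cycle_of_list.simps One_nat_def)

definition Q_seed :: "'a seed \<Rightarrow> 'a list \<Rightarrow> bool" where
  "Q_seed S ys \<longleftrightarrow> fst S = Q \<and> ordered_cluster S = ys"

lemma Q_seed_rho1:
  assumes "Q_seed S [y\<^sub>1, y\<^sub>2, y\<^sub>3, y\<^sub>4, y\<^sub>5]"
  shows "Q_seed (rho1 S) [y\<^sub>2, y\<^sub>3, y\<^sub>4, y\<^sub>5, (y\<^sub>2 * y\<^sub>5 + y\<^sub>3 * y\<^sub>4) / y\<^sub>1]"
  using assms
  by (simp add: Q_seed_def rho_eq_if_quiver_Q ordered_cluster_def mutate_eq vertices_eq Q_table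
      transpose_def del: One_nat_def)

lemma Q_seed_rho2:
  assumes "Q_seed S [y\<^sub>1, y\<^sub>2, y\<^sub>3, y\<^sub>4, y\<^sub>5]"
  shows "Q_seed (rho2 S) [(y\<^sub>1 * y\<^sub>4 + y\<^sub>2 * y\<^sub>3) / y\<^sub>5, y\<^sub>1, y\<^sub>2, y\<^sub>3, y\<^sub>4]"
  using assms
  by (simp add: Q_seed_def rho_eq_if_quiver_Q ordered_cluster_def mutate_eq vertices_eq Q_table
      transpose_def del: One_nat_def)

lemma Q_seed_rho3:
  assumes "Q_seed S [y\<^sub>1, y\<^sub>2, y\<^sub>3, y\<^sub>4, y\<^sub>5]"
  shows "Q_seed (rho3 S)
    [y\<^sub>1, (y\<^sub>1 * y\<^sub>5 + y\<^sub>3\<^sup>2) / y\<^sub>4, y\<^sub>3, (y\<^sub>1 * y\<^sub>5 + y\<^sub>3\<^sup>2) / y\<^sub>2, y\<^sub>5]"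
  using assms
  by (simp add: Q_seed_def rho_eq_if_quiver_Q ordered_cluster_def mutate_eq vertices_eq Q_table
      transpose_def mutate_quiver_apply add.commute power2_eq_square del: One_nat_def)

section \<open>The exponents\<close>

definition quarter_square :: "int \<Rightarrow> int" where
  "quarter_square s = (s div 2) * ((s + 1) div 2)"

lemma quarter_square_second_difference:
  "quarter_square (s + 2) = 2 * quarter_square (s + 1) - quarter_square s + of_bool (even s)"
proof (cases "even s")
  case True
  then obtain m where "s = 2 * m" by blast
  then show ?thesis
    by (simp add: quarter_square_def) (simp add: algebra_simps)
next
  case False
  then obtain m where "s = 2 * m + 1" by (blast elim: oddE)
  then show ?thesis
    by (simp add: quarter_square_def) (simp add: algebra_simps)
qed

lemma g_eq_quarter_square: "g s k = quarter_square (if even k then s else s - 1)"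
  by (simp add: g_def quarter_square_def)

lemma g_second_difference: "g (s + 2) k = 2 * g (s + 1) k - g s k + of_bool (even (k + s))"
  using quarter_square_second_difference[of s] quarter_square_second_difference[of "s - 1"]
  by (simp add: g_eq_quarter_square)

lemma power_int_second_difference:
  fixes c :: "'a :: field"
  assumes "c \<noteq> 0"
  shows "c powi (2 * m - n + d) = (c powi m)\<^sup>2 / c powi n * c powi d"
  using assms by (simp add: power_int_add power_int_diff power_int_mult mult.commute)

section \<open>Somos-5 sequences\<close>

locale somos5 =
  fixes z :: "int \<Rightarrow> 'a :: field"
  assumes nonzero [simp]: "z n \<noteq> 0"
    and recurrence: "z n * z (n + 5) = z (n + 1) * z (n + 4) + z (n + 2) * z (n + 3)"
begin

definition ratio :: "int \<Rightarrow> 'a" where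
  "ratio n = (z n * z (n + 4) + (z (n + 2))\<^sup>2) / (z (n + 1) * z (n + 3))"

lemma ratio_mult: "ratio n * z (n + 1) * z (n + 3) = z n * z (n + 4) + (z (n + 2))\<^sup>2"
  by (simp add: ratio_def)

sublocale ratio: periodic_fun_simple ratio 2
proof
  fix n
  have "z n * z (n + 5) = z (n + 1) * z (n + 4) + z (n + 2) * z (n + 3)"
    and "z (n + 1) * z (n + 6) = z (n + 2) * z (n + 5) + z (n + 3) * z (n + 4)"
    using recurrence[of n] recurrence[of "n + 1"] by (simp_all add: add.assoc)
  then have "(z (n + 2) * z (n + 6) + (z (n + 4))\<^sup>2) * (z (n + 1) * z (n + 3))
      = (z n * z (n + 4) + (z (n + 2))\<^sup>2) * (z (n + 3) * z (n + 5))"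
    by algebra
  then show "ratio (n + 2) = ratio n"
    by (simp add: ratio_def add.assoc frac_eq_eq)
qed

lemma ratio_eq: "ratio n = (if odd n then ratio 1 else ratio 2)"
proof (cases "odd n")
  case True
  then obtain m where "n = 1 + m * 2"
    by (auto elim!: oddE)
  with True show ?thesis
    using ratio.plus_of_int[of 1 m] by simp
next
  case False
  then obtain m where "n = 2 + (m - 1) * 2"
    by (auto elim!: evenE)
  with False show ?thesis
    using ratio.plus_of_int[of 2 "m - 1"] by simp
qed

definition window :: "'a \<Rightarrow> 'a \<Rightarrow> int \<Rightarrow> 'a list" where
  "window p r n = [p * z n, r * z (n + 1), p * z (n + 2), r * z (n + 3), p * z (n + 4)]"

lemma rho1_window:
  assumes "Q_seed S (window p r n)" "p \<noteq> 0"
  shows "Q_seed (rho1 S) (window r p (n + 1))"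
proof -
  have "r * z (n + 1) * (p * z (n + 4)) + p * z (n + 2) * (r * z (n + 3))
      = r * z (n + 5) * (p * z n)"
    using recurrence[of n] by algebra
  then have "(r * z (n + 1) * (p * z (n + 4)) + p * z (n + 2) * (r * z (n + 3))) / (p * z n)
      = r * z (n + 5)"
    using assms(2) by simp
  with Q_seed_rho1[OF assms(1)[unfolded window_def]] show ?thesis
    by (simp add: window_def add.assoc)
qed

lemma rho2_window:
  assumes "Q_seed S (window p r (n + 1))" "p \<noteq> 0"
  shows "Q_seed (rho2 S) (window r p n)"
proof -
  have "p * z (n + 1) * (r * z (n + 4)) + r * z (n + 2) * (p * z (n + 3))
      = r * z n * (p * z (n + 5))"
    using recurrence[of n] by algebra
  then have "(p * z (n + 1) * (r * z (n + 4)) + r * z (n + 2) * (p * z (n + 3))) / (p * z (n + 5))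
      = r * z n"
    using assms(2) by simp
  with Q_seed_rho2[OF assms(1)[unfolded window_def]] show ?thesis
    by (simp add: window_def add.assoc)
qed

lemma rho3_window:
  assumes "Q_seed S (window p r n)" "r \<noteq> 0"
  shows "Q_seed (rho3 S) (window p (ratio n * p\<^sup>2 / r) n)"
proof -
  let ?e = "p * z n * (p * z (n + 4)) + (p * z (n + 2))\<^sup>2"
  have "?e = ratio n * p\<^sup>2 * z (n + 1) * z (n + 3)"
    using ratio_mult[of n] by algebra
  then have "?e / (r * z (n + 3)) = ratio n * p\<^sup>2 / r * z (n + 1)"
    and "?e / (r * z (n + 1)) = ratio n * p\<^sup>2 / r * z (n + 3)"
    using assms(2) by simp_all
  with Q_seed_rho3[OF assms(1)[unfolded window_def]] show ?thesis
    by (simp only: window_def)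
qed

lemma rho1_funpow_window:
  assumes "Q_seed S (window 1 1 n)"
  shows "Q_seed ((rho1 ^^ m) S) (window 1 1 (n + int m))"
proof (induction m)
  case (Suc m)
  then show ?case
    using rho1_window[OF Suc] by (simp add: ac_simps)
qed (simp add: assms)

lemma rho2_funpow_window:
  assumes "Q_seed S (window 1 1 n)"
  shows "Q_seed ((rho2 ^^ m) S) (window 1 1 (n - int m))"
proof (induction m)
  case (Suc m)
  then show ?case
    using rho2_window[of "(rho2 ^^ m) S" 1 1 "n - int (Suc m)"] by simp
qed (simp add: assms)

lemma rho1_pow_window:
  assumes "Q_seed S (window 1 1 n)"
  shows "Q_seed (rho1_pow k S) (window 1 1 (n + k))"
proof (cases "k \<ge> 0")
  case True
  then show ?thesis
    using rho1_funpow_window[OF assms, of "nat k"] by (simp add: rho1_pow_def)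
next
  case False
  then show ?thesis
    using rho2_funpow_window[OF assms, of "nat (- k)"] by (simp add: rho1_pow_def)
qed

definition scale :: "int \<Rightarrow> int \<Rightarrow> 'a" where
  "scale s k = ratio 1 powi g s k * ratio 2 powi g s (k + 1)"

context
  assumes ratio_nonzero: "ratio n \<noteq> 0"
begin

lemma scale_nonzero: "scale s k \<noteq> 0"
  by (simp add: scale_def ratio_nonzero)

lemma scale_second_order: "scale (s + 2) k = ratio (k + s + 1) * (scale (s + 1) k)\<^sup>2 / scale s k"
proof -
  have "ratio 1 powi of_bool (even (k + s)) * ratio 2 powi of_bool (even (k + 1 + s))
      = ratio (k + s + 1)"
    by (simp add: ratio_eq[of "k + s + 1"])
  then show ?thesis
    unfolding scale_def g_second_difference power_int_second_difference[OF ratio_nonzero]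
    by (simp only: power_mult_distrib times_divide_eq_left times_divide_eq_right
        divide_divide_eq_left mult_ac flip: \<open>_ = ratio _\<close>)
qed

lemma rho3_rho1_funpow_window:
  assumes "Q_seed S (window 1 1 1)"
  shows "Q_seed (((rho1 \<circ> rho3) ^^ s) (rho1_pow k S))
    (window (scale (int s + 1) k) (scale (int s) k) (k + int s + 1))"
proof (induction s)
  case 0
  then show ?case
    using rho1_pow_window[OF assms, of k] by (simp add: scale_def g_def add.commute)
next
  case (Suc s)
  let ?S = "((rho1 \<circ> rho3) ^^ s) (rho1_pow k S)"
  have "Q_seed (rho3 ?S) (window (scale (int s + 1) k) (scale (int s + 2) k) (k + int s + 1))"
    using rho3_window[OF Suc scale_nonzero] unfolding scale_second_order .
  then have "Q_seed (rho1 (rho3 ?S))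
      (window (scale (int s + 2) k) (scale (int s + 1) k) (k + int s + 1 + 1))"
    using scale_nonzero by (rule rho1_window)
  then show ?case
    unfolding funpow.simps(2) o_apply by (simp add: ac_simps del: o_apply)
qed

end

end

section \<open>The sequence of rational functions\<close>

lemma zero_less_pCons_iff:
  fixes c :: "'a :: linordered_idom"
  shows "0 < pCons c p \<longleftrightarrow> 0 < p \<or> p = 0 \<and> 0 < c"
  by (simp add: less_poly_def pos_poly_pCons)

lemma indet_pos: "1 \<le> n \<Longrightarrow> n \<le> 5 \<Longrightarrow> 0 < indet n"
  by (auto simp: indet_def Fraction_Field.zero_less_Fract_iff zero_less_pCons_iff)

lemma x_eq_indet: "1 \<le> n \<Longrightarrow> n \<le> 5 \<Longrightarrow> x n = indet n"
  by (subst x.simps) simp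

lemma x_pos: "0 < x n"
proof (induction n rule: x.induct)
  case (1 n)
  show ?case
    using 1 by (subst x.simps) (auto intro!: divide_pos_pos add_pos_pos mult_pos_pos indet_pos)
qed

lemma x_recurrence: "x n * x (n + 5) = x (n + 1) * x (n + 4) + x (n + 2) * x (n + 3)"
proof (cases "n \<ge> 1")
  case True
  then show ?thesis
    using x_pos[of n] by (subst (2) x.simps) (simp add: ac_simps)
next
  case False
  then show ?thesis
    using x_pos[of "n + 5"] by (subst (1) x.simps) simp
qed

interpretation x: somos5 x
  using x_recurrence x_pos by unfold_locales (auto simp: less_le)

lemma x_ratio_nonzero: "x.ratio n \<noteq> 0"
proof -
  have "0 < x.ratio n"
    unfolding x.ratio_def
    by (intro divide_pos_pos add_pos_pos mult_pos_pos zero_less_power x_pos)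
  then show ?thesis by simp
qed

lemma x_ratio_1: "x.ratio 1 = A" and x_ratio_2: "x.ratio 2 = B"
  by (simp_all add: x.ratio_def A_def B_def)

lemma Q_seed_initial_seed: "Q_seed initial_seed (x.window 1 1 1)"
  by (simp add: Q_seed_def x.window_def initial_seed_def ordered_cluster_def x_eq_indet)

theorem theorem4p4:
  fixes k :: int and s :: nat
  shows "ordered_cluster (((rho1 \<circ> rho3) ^^ s) (rho1_pow k initial_seed)) =
    [A powi g (int s + 1) k * B powi g (int s + 1) (k + 1) * x (k + int s + 1),
     A powi g (int s) k * B powi g (int s) (k + 1) * x (k + int s + 2),
     A powi g (int s + 1) k * B powi g (int s + 1) (k + 1) * x (k + int s + 3),
     A powi g (int s) k * B powi g (int s) (k + 1) * x (k + int s + 4),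
     A powi g (int s + 1) k * B powi g (int s + 1) (k + 1) * x (k + int s + 5)]"
proof -
  have "ordered_cluster (((rho1 \<circ> rho3) ^^ s) (rho1_pow k initial_seed)) =
      x.window (x.scale (int s + 1) k) (x.scale (int s) k) (k + int s + 1)"
    using x.rho3_rho1_funpow_window[OF x_ratio_nonzero Q_seed_initial_seed]
    by (simp add: Q_seed_def)
  then show ?thesis
    by (simp add: x.window_def x.scale_def x_ratio_1 x_ratio_2 add.assoc)
qed

end
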